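(* Let $\ell\ge 2$. Let $\mu$ be an $\ell$-core with $\mu_1-\mu_2\neq \ell-1$, let $r\ge 0$ be an integer, and let $\kappa=(\kappa_1,\dots,\kappa_{r+1})$ be a partition with at most $r+1$ parts. Then the partition $\lambda\approx(\mu,r,\kappa)$ is an $\ell$-partition. Conversely, every $\ell$-partition corresponds uniquely to such a triple $(\mu,r,\kappa)$, i.e. for every $\ell$-partition $\lambda$ there is exactly one such triple with $\lambda\approx(\mu,r,\kappa)$.
   Context: A partition is $\ell$-regular if it does not have $\ell$ or more equal nonzero parts. A removable $\ell$-rim hook (for short, $\ell$-rim hook) of $\lambda$ is a connected sequence of $\ell$ boxes of the Young diagram of $\lambda$, containing no $2\times2$ square, whose removal from $\lambda$ leaves the Young diagram of a partition. It is horizontal if all its boxes lie in one row, and non-horizontal otherwise. An $\ell$-core is a partition with no removable $\ell$-rim hook. An $\ell$-partition is an $\ell$-regular partition which has no non-horizontal $\ell$-rim hooks and such that, after removing any number of horizontal $\ell$-rim hooks in any order, the remaining diagram has no non-horizontal $\ell$-rim hooks. Partitions are extended by parts equal to $0$ when needed. For $\mu=(\mu_1,\dots,\mu_s)$, $r$, $\kappa$ as in the claim, let $\nu$ be the partition with $\nu_{j}=\mu_1+(r-j+1)(\ell-1)$ for $1\le j\le r$ and $\nu_{r+i}=\mu_i$ for $i\ge 1$. The notation $\lambda\approx(\mu,r,\kappa)$ means that $\lambda_i=\nu_i+\ell\kappa_i$ for $1\le i\le r+1$ and $\lambda_i=\nu_i$ for $i>r+1$. *)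

theory Defs
  imports Main
begin

text \<open>
  A partition is the weakly decreasing, eventually zero sequence of its parts, padded by zeros.
  Rows, columns and parts are indexed from 0, so \<open>p i\<close> is the part usually written
  \<open>p\<^sub>i\<^sub>+\<^sub>1\<close>.
\<close>

definition is_partition :: "(nat \<Rightarrow> nat) \<Rightarrow> bool" where
  "is_partition p \<longleftrightarrow> antimono p \<and> finite {i. p i \<noteq> 0}"

definition regular :: "nat \<Rightarrow> (nat \<Rightarrow> nat) \<Rightarrow> bool" where
  "regular l p \<longleftrightarrow> (\<forall>m>0. card {i. p i = m} < l)"

type_synonym box = "nat \<times> nat"

definition young_diagram :: "(nat \<Rightarrow> nat) \<Rightarrow> box set" where
  "young_diagram p = {(i, j). j < p i}"

definition adjacent :: "box \<Rightarrow> box \<Rightarrow> bool" where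
  "adjacent a b \<longleftrightarrow>
     fst a = fst b \<and> (snd b = Suc (snd a) \<or> snd a = Suc (snd b)) \<or>
     snd a = snd b \<and> (fst b = Suc (fst a) \<or> fst a = Suc (fst b))"

definition connected_boxes :: "box set \<Rightarrow> bool" where
  "connected_boxes H \<longleftrightarrow>
     (\<forall>a\<in>H. \<forall>b\<in>H. (\<lambda>x y. x \<in> H \<and> y \<in> H \<and> adjacent x y)\<^sup>*\<^sup>* a b)"

definition contains_square :: "box set \<Rightarrow> bool" where
  "contains_square H \<longleftrightarrow>
     (\<exists>i j. {(i, j), (i, Suc j), (Suc i, j), (Suc i, Suc j)} \<subseteq> H)"

definition rim_hook :: "nat \<Rightarrow> (nat \<Rightarrow> nat) \<Rightarrow> box set \<Rightarrow> bool" where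
  "rim_hook l p H \<longleftrightarrow>
     H \<subseteq> young_diagram p \<and> card H = l \<and> connected_boxes H \<and> \<not> contains_square H \<and>
     (\<exists>q. is_partition q \<and> young_diagram q = young_diagram p - H)"

definition horizontal :: "box set \<Rightarrow> bool" where
  "horizontal H \<longleftrightarrow> (\<exists>i. \<forall>b\<in>H. fst b = i)"

definition core :: "nat \<Rightarrow> (nat \<Rightarrow> nat) \<Rightarrow> bool" where
  "core l p \<longleftrightarrow> is_partition p \<and> (\<nexists>H. rim_hook l p H)"

definition remove_horizontal :: "nat \<Rightarrow> (nat \<Rightarrow> nat) \<Rightarrow> (nat \<Rightarrow> nat) \<Rightarrow> bool" where
  "remove_horizontal l p q \<longleftrightarrow>
     (\<exists>H. rim_hook l p H \<and> horizontal H \<and> is_partition q \<and>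
          young_diagram q = young_diagram p - H)"

text \<open>
  The reflexive-transitive closure covers any number of removals, including none, so the
  absence of non-horizontal hooks in \<open>p\<close> itself is part of the last condition.
\<close>

definition l_partition :: "nat \<Rightarrow> (nat \<Rightarrow> nat) \<Rightarrow> bool" where
  "l_partition l p \<longleftrightarrow>
     is_partition p \<and> regular l p \<and>
     (\<forall>q. (remove_horizontal l)\<^sup>*\<^sup>* p q \<longrightarrow> (\<nexists>H. rim_hook l q H \<and> \<not> horizontal H))"

text \<open>With 0-based rows, the factor \<open>r - j + 1\<close> of the 1-based formula becomes \<open>r - j\<close>.\<close>

definition nu :: "nat \<Rightarrow> (nat \<Rightarrow> nat) \<Rightarrow> nat \<Rightarrow> nat \<Rightarrow> nat" where
  "nu l \<mu> r j = (if j < r then \<mu> 0 + (r - j) * (l - 1) else \<mu> (j - r))"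

definition assemble :: "nat \<Rightarrow> (nat \<Rightarrow> nat) \<Rightarrow> nat \<Rightarrow> (nat \<Rightarrow> nat) \<Rightarrow> nat \<Rightarrow> nat" where
  "assemble l \<mu> r \<kappa> i = (if i \<le> r then nu l \<mu> r i + l * \<kappa> i else nu l \<mu> r i)"

text \<open>\<open>decomposes l p (\<mu>, r, \<kappa>)\<close> is the relation \<open>p \<approx> (\<mu>, r, \<kappa>)\<close>.\<close>

definition decomposes ::
    "nat \<Rightarrow> (nat \<Rightarrow> nat) \<Rightarrow> (nat \<Rightarrow> nat) \<times> nat \<times> (nat \<Rightarrow> nat) \<Rightarrow> bool" where
  "decomposes l p t \<longleftrightarrow> (case t of (\<mu>, r, \<kappa>) \<Rightarrow> p = assemble l \<mu> r \<kappa>)"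

definition admissible :: "nat \<Rightarrow> (nat \<Rightarrow> nat) \<times> nat \<times> (nat \<Rightarrow> nat) \<Rightarrow> bool" where
  "admissible l t \<longleftrightarrow> (case t of (\<mu>, r, \<kappa>) \<Rightarrow>
     core l \<mu> \<and> \<mu> 0 - \<mu> 1 \<noteq> l - 1 \<and>
     is_partition \<kappa> \<and> (\<forall>i>r. \<kappa> i = 0))"

end

theory Submission
  imports Defs
begin

text \<open>
  In terms of the strictly decreasing numbers \<open>p i - i\<close>, removing an \<open>l\<close>-rim hook subtracts \<open>l\<close>
  from one of these numbers so that the result is new: a hook occupying the rows \<open>a, \<dots>, b\<close> moves
  \<open>p a - a\<close> strictly between \<open>p (b + 1) - (b + 1)\<close> and \<open>p b - b\<close>. With this description, horizontal
  removals from \<open>assemble l \<mu> r \<kappa>\<close> just remove boxes from \<open>\<kappa>\<close>. Conversely, an \<open>l\<close>-partition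
  without horizontal hooks is a core, of which \<open>r\<close> counts the leading gaps equal to \<open>l - 1\<close>; in
  general one removes the topmost horizontal hook and argues by induction on the size.
\<close>

section \<open>Rim hooks as intervals of rows\<close>

text \<open>Over the integers this reads \<open>p (Suc b) - Suc b < p a - a - l < p b - b\<close>;
  the subtractions are cleared so that it can be stated in \<open>nat\<close>. For
  \<open>a = b\<close> the right half only says \<open>l > 0\<close>.\<close>

definition hook_rows :: "nat \<Rightarrow> (nat \<Rightarrow> nat) \<Rightarrow> nat \<Rightarrow> nat \<Rightarrow> bool" where
  "hook_rows l p a b \<longleftrightarrow>
     a \<le> b \<and> p (Suc b) + a + l \<le> p a + b \<and> p a + b < p b + a + l"

lemma mem_young_diagram [simp]: "(i, j) \<in> young_diagram p \<longleftrightarrow> j < p i"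
  by (simp add: young_diagram_def)

lemma is_partitionD: "is_partition p \<Longrightarrow> i \<le> j \<Longrightarrow> p j \<le> p i"
  by (simp add: is_partition_def antimono_def)

lemma is_partition_iff:
  "is_partition p \<longleftrightarrow> (\<forall>i. p (Suc i) \<le> p i) \<and> finite {i. p i \<noteq> 0}"
  unfolding is_partition_def using antimono_iff_le_Suc[of p] by auto

lemma young_diagram_subset_iff: "young_diagram q \<subseteq> young_diagram p \<longleftrightarrow> q \<le> p"
proof
  assume *: "young_diagram q \<subseteq> young_diagram p"
  show "q \<le> p"
  proof (rule le_funI, rule ccontr)
    fix i assume "\<not> q i \<le> p i"
    then have "(i, p i) \<in> young_diagram q" by simp
    with * have "(i, p i) \<in> young_diagram p" by blast
    then show False by simp
  qed
next
  assume "q \<le> p"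
  then show "young_diagram q \<subseteq> young_diagram p"
    unfolding young_diagram_def le_fun_def using order.strict_trans2 by blast
qed

lemma finite_young_diagram:
  assumes "is_partition p" shows "finite (young_diagram p)"
proof (rule finite_subset)
  show "young_diagram p \<subseteq> {i. p i \<noteq> 0} \<times> {..<p 0}"
  proof clarify
    fix i j assume "(i, j) \<in> young_diagram p"
    then show "i \<in> {i. p i \<noteq> 0} \<and> j \<in> {..<p 0}"
      using is_partitionD[OF assms, of 0 i] by simp
  qed
  show "finite ({i. p i \<noteq> 0} \<times> {..<p 0})" using assms by (simp add: is_partition_def)
qed

text \<open>Each row above the last loses \<open>p i - p (Suc i) + 1\<close> boxes, so the sum
  telescopes. This turns the size of a hook into the shift by \<open>l\<close>.\<close>

lemma sum_rim_rows:
  fixes p q :: "nat \<Rightarrow> nat"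
  assumes "a \<le> b" and "\<And>i. a \<le> i \<Longrightarrow> i < b \<Longrightarrow> Suc (q i) = p (Suc i)"
    and "\<And>i. a \<le> i \<Longrightarrow> i < b \<Longrightarrow> q i \<le> p i"
  shows "(\<Sum>i=a..<b. p i - q i) + p b + a = p a + b"
  using assms
proof (induction b rule: dec_induct)
  case base
  then show ?case by simp
next
  case (step n)
  then have "(\<Sum>i=a..<n. p i - q i) + p n + a = p a + n" by simp
  moreover have "Suc (q n) = p (Suc n)" "q n \<le> p n" using step by simp_all
  ultimately show ?case using step.hyps by (simp add: sum.atLeastLessThan_Suc)
qed

text \<open>A path changes its row by at most one per step, so it must step from row
  \<open>i\<close> to row \<open>Suc i\<close>, and such a step stays in its column.\<close>

lemma connected_boxes_crossing:
  assumes "connected_boxes H" "x \<in> H" "y \<in> H" "fst x \<le> i" "i < fst y"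
  obtains j where "(i, j) \<in> H" "(Suc i, j) \<in> H"
proof -
  let ?R = "\<lambda>x y. x \<in> H \<and> y \<in> H \<and> adjacent x y"
  have "?R\<^sup>*\<^sup>* x y" using assms unfolding connected_boxes_def by blast
  then have "fst y \<le> i \<or> (\<exists>j. (i, j) \<in> H \<and> (Suc i, j) \<in> H)"
  proof induction
    case base
    then show ?case using assms by simp
  next
    case (step y z)
    show ?case
    proof (cases "fst y \<le> i \<and> i < fst z")
      case True
      then have "fst y = i" "fst z = Suc i" "snd y = snd z"
        using step.hyps(2) by (auto simp: adjacent_def)
      then have "(i, snd y) \<in> H" "(Suc i, snd y) \<in> H"
        using step.hyps(2) by (metis prod.collapse)+
      then show ?thesis by blast
    qed (use step.IH in auto)
  qed
  then show thesis using assms(5) that by auto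
qed

text \<open>Row \<open>i\<close> of \<open>H\<close> is the interval from \<open>q i\<close> to
  \<open>p i - 1\<close>. Connectedness makes consecutive rows share a column and the absence of a
  square allows only one, so \<open>Suc (q i) = p (Suc i)\<close>; counting boxes then determines
  \<open>q b\<close>.\<close>

lemma rim_hook_rows:
  assumes p: "is_partition p" and l: "l > 0" and H: "rim_hook l p H"
  obtains a b where "hook_rows l p a b" "fst ` H = {a..b}"
proof -
  obtain q where q: "is_partition q" and yq: "young_diagram q = young_diagram p - H"
    using H by (auto simp: rim_hook_def)
  have sub: "H \<subseteq> young_diagram p" and card: "card H = l" and con: "connected_boxes H"
    and nsq: "\<not> contains_square H" using H by (auto simp: rim_hook_def)
  have qp: "q i \<le> p i" for i
    using yq young_diagram_subset_iff[of q p] by (auto simp: le_fun_def)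
  have "H = young_diagram p - young_diagram q" using sub yq by blast
  then have mem: "(i, j) \<in> H \<longleftrightarrow> q i \<le> j \<and> j < p i" for i j by auto
  have fin: "finite H" and ne: "H \<noteq> {}" using card l by (auto intro: card_ge_0_finite)
  define a where "a = Min (fst ` H)"
  define b where "b = Max (fst ` H)"
  have "a \<in> fst ` H" "b \<in> fst ` H" unfolding a_def b_def using fin ne by simp_all
  then obtain x y where x: "x \<in> H" "fst x = a" and y: "y \<in> H" "fst y = b" by auto
  have rows: "fst ` H \<subseteq> {a..b}" unfolding a_def b_def
    using fin by (meson Max_ge Min_le atLeastAtMost_iff finite_imageI subsetI)
  have ab: "a \<le> b" using \<open>a \<in> fst ` H\<close> rows by auto
  have step: "Suc (q i) = p (Suc i)" if i: "a \<le> i" "i < b" for i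
  proof -
    obtain j where "(i, j) \<in> H" "(Suc i, j) \<in> H"
      using connected_boxes_crossing[OF con x(1) y(1), of i] i unfolding x(2) y(2) by blast
    then have "q i < p (Suc i)" by (simp add: mem)
    moreover have "\<not> Suc (q i) < p (Suc i)"
    proof
      assume "Suc (q i) < p (Suc i)"
      \<comment> \<open>The columns \<open>q i\<close> and \<open>Suc (q i)\<close> would both be
        shared by the rows \<open>i\<close> and \<open>Suc i\<close>.\<close>
      then have "{(i, q i), (i, Suc (q i)), (Suc i, q i), (Suc i, Suc (q i))} \<subseteq> H"
        using is_partitionD[OF p, of i "Suc i"] is_partitionD[OF q, of i "Suc i"]
        by (auto simp: mem)
      with nsq show False unfolding contains_square_def by blast
    qed
    ultimately show ?thesis by simp
  qed
  have qb: "q b < p b" using y mem[of b "snd y"] by (metis le_less_trans prod.collapse)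
  have "\<not> q (Suc b) < p (Suc b)"
  proof
    assume "q (Suc b) < p (Suc b)"
    then have "(Suc b, q (Suc b)) \<in> H" by (simp add: mem)
    then have "Suc b \<in> fst ` H" by force
    with rows show False by auto
  qed
  then have below: "p (Suc b) \<le> q b"
    using is_partitionD[OF q, of b "Suc b"] by simp
  have "(i, q i) \<in> H" if "i \<in> {a..b}" for i
  proof (cases "i < b")
    case True
    then show ?thesis
      using that step[of i] is_partitionD[OF p, of i "Suc i"] by (simp add: mem)
  next
    case False
    then show ?thesis using that qb by (simp add: mem)
  qed
  then have fstH: "fst ` H = {a..b}" using rows by force
  have "H = Sigma {a..b} (\<lambda>i. {q i..<p i})" using rows by (force simp: mem)
  then have "card H = (\<Sum>i\<in>{a..b}. p i - q i)" by simp
  also have "\<dots> = (\<Sum>i=a..<b. p i - q i) + (p b - q b)"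
    using ab by (simp add: sum.last_plus add.commute)
  finally have "l + q b + a = p a + b"
    using sum_rim_rows[of a b q p] ab step qp card qb by simp
  then have "hook_rows l p a b" unfolding hook_rows_def using ab qb below by simp
  then show thesis using fstH that by blast
qed

lemma horizontal_rows: "fst ` H = {a..b} \<Longrightarrow> a \<le> b \<Longrightarrow> horizontal H \<longleftrightarrow> a = b"
proof -
  assume H: "fst ` H = {a..b}" and ab: "a \<le> b"
  have "horizontal H \<longleftrightarrow> (\<exists>i. \<forall>k\<in>fst ` H. k = i)" by (auto simp: horizontal_def)
  also have "\<dots> \<longleftrightarrow> a = b" unfolding H
  proof
    assume "\<exists>i. \<forall>k\<in>{a..b}. k = i"
    then show "a = b" using ab by (metis atLeastAtMost_iff order_refl)
  qed simp
  finally show ?thesis .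
qed

text \<open>After \<open>p a - a\<close> is replaced by \<open>p a - a - l\<close>, sorting the
  numbers again moves those of the rows \<open>Suc a\<close> to \<open>b\<close> up by one row. The
  result is the partition that the hook leaves.\<close>

lemma rim_hook_exists:
  assumes p: "is_partition p" and h: "hook_rows l p a b"
  obtains H where "rim_hook l p H" "fst ` H = {a..b}"
proof -
  have ab: "a \<le> b" and below: "p (Suc b) + a + l \<le> p a + b" and above: "p a + b < p b + a + l"
    using h by (auto simp: hook_rows_def)
  \<comment> \<open>The re-sorted sequence: \<open>q i - i\<close> is
    \<open>p (Suc i) - Suc i\<close> for \<open>a \<le> i < b\<close>, and \<open>q b - b\<close> is
    \<open>p a - a - l\<close>.\<close>
  define q where "q i = (if a \<le> i \<and> i < b then p (Suc i) - 1
                         else if i = b then p a + b - a - l else p i)" for i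
  \<comment> \<open>The two bounds on \<open>p a + b\<close> give \<open>p (Suc b) < p b\<close>, so
    the subtraction of 1 in \<open>q\<close> is not truncated.\<close>
  have pos: "p i > 0" if "i \<le> b" for i
    using is_partitionD[OF p that] below above by linarith
  have overlap: "Suc (q i) = p (Suc i)" if "a \<le> i" "i < b" for i
    using pos[of "Suc i"] that by (simp add: q_def)
  have qb: "q b + a + l = p a + b" using below by (simp add: q_def)
  have q_less: "q i < p i" if "a \<le> i" "i \<le> b" for i
  proof (cases "i < b")
    case True
    then show ?thesis using overlap[of i] that is_partitionD[OF p, of i "Suc i"] by simp
  next
    case False
    then show ?thesis using that qb above by simp
  qed
  have q_out: "q i = p i" if "\<not> (a \<le> i \<and> i \<le> b)" for i using that ab by (auto simp: q_def)
  have qp: "q i \<le> p i" for i using q_less[of i] q_out[of i] by fastforce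
  have "q (Suc i) \<le> q i" for i
  proof -
    consider "a \<le> i" "i < b" | "i = b" | "i < a \<or> b < i" by linarith
    then show ?thesis
    proof cases
      case 1
      then show ?thesis using overlap[of i] q_less[of "Suc i"] by simp
    next
      case 2
      then show ?thesis using qb below q_out[of "Suc b"] by simp
    next
      case 3
      then have "q i = p i" using q_out[of i] by auto
      then show ?thesis using qp[of "Suc i"] is_partitionD[OF p, of i "Suc i"] by simp
    qed
  qed
  moreover have "finite {i. q i \<noteq> 0}"
  proof (rule finite_subset)
    show "{i. q i \<noteq> 0} \<subseteq> {i. p i \<noteq> 0}"
    proof (rule subsetI)
      fix i assume "i \<in> {i. q i \<noteq> 0}"
      then show "i \<in> {i. p i \<noteq> 0}" using qp[of i] by simp
    qed
    show "finite {i. p i \<noteq> 0}" using p by (simp add: is_partition_def)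
  qed
  ultimately have q: "is_partition q" by (simp add: is_partition_iff)
  define H where "H = young_diagram p - young_diagram q"
  have mem: "(i, j) \<in> H \<longleftrightarrow> q i \<le> j \<and> j < p i" for i j by (auto simp: H_def)
  have yq: "young_diagram q = young_diagram p - H"
    using qp young_diagram_subset_iff[of q p] by (auto simp: H_def le_fun_def)
  have rows: "a \<le> i \<and> i \<le> b" if "(i, j) \<in> H" for i j
    using that q_out[of i] by (auto simp: mem)
  have Sig: "H = Sigma {a..b} (\<lambda>i. {q i..<p i})" using rows by (force simp: mem)
  have "(i, q i) \<in> H" if "i \<in> {a..b}" for i using that q_less by (simp add: mem)
  then have fstH: "fst ` H = {a..b}" using rows by force
  have "card H = (\<Sum>i\<in>{a..b}. p i - q i)" unfolding Sig by simp
  also have "\<dots> = (\<Sum>i=a..<b. p i - q i) + (p b - q b)"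
    using ab by (simp add: sum.last_plus add.commute)
  finally have card: "card H = l"
    using sum_rim_rows[of a b q p] ab overlap qp[of b] qp qb by simp
  have nsq: "\<not> contains_square H"
  proof
    assume "contains_square H"
    then obtain i j where *: "(i, j) \<in> H" "(Suc i, Suc j) \<in> H"
      by (auto simp: contains_square_def)
    then have "Suc (q i) = p (Suc i)" using overlap[of i] rows by fastforce
    with * show False by (simp add: mem)
  qed
  \<comment> \<open>Every box is joined to \<open>(b, q b)\<close>; symmetry of the step relation
    then joins any two boxes.\<close>
  let ?R = "\<lambda>x y. x \<in> H \<and> y \<in> H \<and> adjacent x y"
  have sym: "?R\<^sup>*\<^sup>* y x" if "?R\<^sup>*\<^sup>* x y" for x y
    using that
  proof induction
    case base
    then show ?case by simp
  next
    case (step y z)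
    then have "?R z y" by (auto simp: adjacent_def)
    then show ?case using step.IH by (rule converse_rtranclp_into_rtranclp)
  qed
  have left: "?R\<^sup>*\<^sup>* (i, j) (i, q i)" if "(i, j) \<in> H" for i j
  proof -
    have "q i \<le> j" using that by (simp add: mem)
    then show ?thesis using that
    proof (induction j rule: dec_induct)
      case base
      then show ?case by simp
    next
      case (step n)
      then have "?R (i, Suc n) (i, n)" by (simp add: mem adjacent_def)
      moreover have "?R\<^sup>*\<^sup>* (i, n) (i, q i)" using step by (simp add: mem)
      ultimately show ?case by (rule converse_rtranclp_into_rtranclp)
    qed
  qed
  have down: "?R\<^sup>*\<^sup>* (i, q i) (b, q b)" if "a \<le> i" "i \<le> b" for i
    using that(2,1)
  proof (induction i rule: inc_induct)
    case base
    then show ?case by simp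
  next
    case (step n)
    have n: "Suc (q n) = p (Suc n)" using overlap step by simp
    have "q n < p n" "q (Suc n) < p (Suc n)" using q_less step by simp_all
    \<comment> \<open>The column of the first box of row \<open>n\<close> meets row
      \<open>Suc n\<close> in its last box, from where one walks left again.\<close>
    with n have down_one: "?R (n, q n) (Suc n, q n)" by (simp add: mem adjacent_def)
    then have "?R\<^sup>*\<^sup>* (Suc n, q n) (Suc n, q (Suc n))" using left by blast
    moreover have "?R\<^sup>*\<^sup>* (Suc n, q (Suc n)) (b, q b)" using step by simp
    ultimately have "?R\<^sup>*\<^sup>* (Suc n, q n) (b, q b)" by (rule rtranclp_trans)
    with down_one show ?case by (rule converse_rtranclp_into_rtranclp)
  qed
  have reach: "?R\<^sup>*\<^sup>* x (b, q b)" if "x \<in> H" for x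
  proof -
    obtain i j where x: "x = (i, j)" by (cases x)
    show ?thesis using left[of i j] down[of i] rows[of i j] that unfolding x
      by (meson rtranclp_trans)
  qed
  have "connected_boxes H" unfolding connected_boxes_def
    using reach sym by (meson rtranclp_trans)
  moreover have "H \<subseteq> young_diagram p" by (simp add: H_def)
  ultimately have "rim_hook l p H" unfolding rim_hook_def using card nsq q yq by blast
  then show thesis using fstH that by blast
qed

section \<open>Cores, horizontal removals and regularity in terms of rows\<close>

lemma nonhorizontal_iff:
  assumes "is_partition p" "l > 0"
  shows "(\<exists>H. rim_hook l p H \<and> \<not> horizontal H) \<longleftrightarrow> (\<exists>a b. a < b \<and> hook_rows l p a b)"
proof
  assume "\<exists>H. rim_hook l p H \<and> \<not> horizontal H"
  then obtain H where H: "rim_hook l p H" "\<not> horizontal H" by blast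
  obtain a b where "hook_rows l p a b" "fst ` H = {a..b}"
    using rim_hook_rows[OF assms H(1)] .
  moreover from this H(2) have "a < b"
    using horizontal_rows[of H a b] by (auto simp: hook_rows_def)
  ultimately show "\<exists>a b. a < b \<and> hook_rows l p a b" by blast
next
  assume "\<exists>a b. a < b \<and> hook_rows l p a b"
  then obtain a b where ab: "a < b" "hook_rows l p a b" by blast
  obtain H where "rim_hook l p H" "fst ` H = {a..b}"
    using rim_hook_exists[OF assms(1) ab(2)] .
  then show "\<exists>H. rim_hook l p H \<and> \<not> horizontal H"
    using horizontal_rows[of H a b] ab(1) by auto
qed

lemma core_iff:
  assumes "l > 0"
  shows "core l p \<longleftrightarrow> is_partition p \<and> (\<forall>a b. \<not> hook_rows l p a b)"
  unfolding core_def using rim_hook_rows[OF _ assms] rim_hook_exists by metis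

text \<open>A horizontal hook consists of the last \<open>l\<close> boxes of one row, and what is
  left must not be shorter than the next row.\<close>

lemma remove_horizontal_iff:
  assumes p: "is_partition p" and l: "l > 0"
  shows "remove_horizontal l p q \<longleftrightarrow> (\<exists>i. p (Suc i) + l \<le> p i \<and> q = p(i := p i - l))"
proof -
  have forward: "p (Suc i) + l \<le> p i \<and> q = p(i := p i - l)"
    if H: "rim_hook l p H" and fstH: "fst ` H = {i}"
      and q: "is_partition q" and yq: "young_diagram q = young_diagram p - H" for H i q
  proof -
    have sub: "H \<subseteq> young_diagram p" and card: "card H = l" using H by (auto simp: rim_hook_def)
    then have "H = young_diagram p - young_diagram q" using yq by blast
    then have mem: "(k, j) \<in> H \<longleftrightarrow> q k \<le> j \<and> j < p k" for k j by auto
    have qp: "q k \<le> p k" for k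
      using yq young_diagram_subset_iff[of q p] by (auto simp: le_fun_def)
    have other: "q k = p k" if "k \<noteq> i" for k
    proof (rule ccontr)
      assume "q k \<noteq> p k"
      then have "(k, q k) \<in> H" using qp[of k] by (simp add: mem)
      then have "k \<in> fst ` H" by force
      then show False using fstH that by simp
    qed
    have "H = {i} \<times> {q i..<p i}" using fstH by (force simp: mem)
    then have "p i - q i = l" using card by simp
    with l have qi: "q i + l = p i" by simp
    moreover have "p (Suc i) \<le> q i" using other[of "Suc i"] is_partitionD[OF q, of i "Suc i"] by simp
    moreover have "q = p(i := p i - l)" using qi other by (auto simp: fun_eq_iff)
    ultimately show ?thesis by simp
  qed
  show ?thesis
  proof
    assume "remove_horizontal l p q"
    then obtain H where H: "rim_hook l p H" "horizontal H" "is_partition q"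
      "young_diagram q = young_diagram p - H" by (auto simp: remove_horizontal_def)
    obtain a b where "hook_rows l p a b" "fst ` H = {a..b}"
      using rim_hook_rows[OF p l H(1)] .
    moreover from this H(2) have "a = b"
      using horizontal_rows[of H a b] by (auto simp: hook_rows_def)
    ultimately have "fst ` H = {a}" by simp
    then show "\<exists>i. p (Suc i) + l \<le> p i \<and> q = p(i := p i - l)" using forward H by blast
  next
    assume "\<exists>i. p (Suc i) + l \<le> p i \<and> q = p(i := p i - l)"
    then obtain i where i: "p (Suc i) + l \<le> p i" "q = p(i := p i - l)" by blast
    then have "hook_rows l p i i" using l by (simp add: hook_rows_def)
    then obtain H where H: "rim_hook l p H" "fst ` H = {i..i}"
      using rim_hook_exists[OF p] by blast
    \<comment> \<open>The hook is known only by its rows; \<open>forward\<close> identifies the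
      partition it leaves as \<open>q\<close>.\<close>
    obtain q' where q': "is_partition q'" "young_diagram q' = young_diagram p - H"
      using H(1) by (auto simp: rim_hook_def)
    then have "q' = q" using forward[of H i q'] H i by simp
    then show "remove_horizontal l p q" unfolding remove_horizontal_def
      using H q' horizontal_rows[of H i i] by auto
  qed
qed

text \<open>If \<open>l\<close> rows have the same positive length, the last boxes of the lowest
  \<open>l\<close> of them form a vertical hook, which is non-horizontal because
  \<open>l \<ge> 2\<close>.\<close>

lemma regularI:
  assumes p: "is_partition p" and l: "l \<ge> 2" and nh: "\<And>a b. a < b \<Longrightarrow> \<not> hook_rows l p a b"
  shows "regular l p"
  unfolding regular_def
proof (intro allI impI, rule ccontr)
  fix m :: nat
  assume m: "m > 0" and big: "\<not> card {i. p i = m} < l"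
  let ?S = "{i. p i = m}"
  have fin: "finite ?S" using big l by (intro card_ge_0_finite) simp
  have ne: "?S \<noteq> {}" using big l by (metis card.empty gr_zeroI not_less_eq_eq not_numeral_le_zero)
  define k where "k = Max ?S"
  have k: "p k = m" using Max_in[OF fin ne] by (simp add: k_def)
  have kmax: "i \<le> k" if "p i = m" for i using Max_ge[OF fin, of i] that by (simp add: k_def)
  have "p (Suc k) \<noteq> m" using kmax[of "Suc k"] by auto
  then have below: "p (Suc k) < m" using is_partitionD[OF p, of k "Suc k"] k by simp
  obtain a where a: "p a = m" "a + l \<le> Suc k"
  proof (rule ccontr)
    assume none: "\<not> thesis"
    \<comment> \<open>Otherwise all rows of length \<open>m\<close> would lie among the last
      \<open>l - 1\<close> rows up to \<open>k\<close>.\<close>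
    have "?S \<subseteq> {Suc (Suc k) - l..k}"
    proof (rule subsetI)
      fix i assume "i \<in> ?S"
      then have i: "p i = m" by simp
      then have "\<not> i + l \<le> Suc k" using that none by blast
      then show "i \<in> {Suc (Suc k) - l..k}" using kmax[OF i] by auto
    qed
    then have "card ?S \<le> Suc k - (Suc (Suc k) - l)"
      using card_mono[of "{Suc (Suc k) - l..k}" ?S] by simp
    with big l show False by linarith
  qed
  \<comment> \<open>The first of the \<open>l\<close> consecutive rows ending at \<open>k\<close>;
    it lies between \<open>a\<close> and \<open>k\<close>, so monotonicity gives it length
    \<open>m\<close>.\<close>
  define c where "c = Suc k - l"
  have c: "c + l = Suc k" "a \<le> c" using a by (auto simp: c_def)
  have "p c = m"
    using is_partitionD[OF p c(2)] is_partitionD[OF p, of c k] a k c l by simp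
  then have "hook_rows l p c k" using k below c l by (simp add: hook_rows_def)
  moreover have "c < k" using c l by simp
  ultimately show False using nh by blast
qed

text \<open>Removals from \<open>q\<close> extend to removals from \<open>p\<close>, which settles
  the hook condition; regularity then follows by \<open>regularI\<close>.\<close>

lemma l_partition_step:
  assumes "l_partition l p" "remove_horizontal l p q" "l \<ge> 2"
  shows "l_partition l q"
proof -
  have q: "is_partition q" using assms(2) by (auto simp: remove_horizontal_def)
  have nh: "\<nexists>H. rim_hook l s H \<and> \<not> horizontal H" if "(remove_horizontal l)\<^sup>*\<^sup>* q s" for s
    using assms(1) converse_rtranclp_into_rtranclp[OF assms(2) that] by (simp add: l_partition_def)
  have "regular l q"
    using regularI[OF q assms(3)] nonhorizontal_iff[OF q, of l] nh[of q] assms(3) by auto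
  then show ?thesis using q nh by (simp add: l_partition_def)
qed

section \<open>Row gaps of assembled partitions\<close>

text \<open>A gap of at least \<open>l\<close> would admit a one-row hook. The last bound also uses
  the excluded value \<open>l - 1\<close> of the first gap.\<close>

lemma admissible_gap:
  assumes "admissible l (\<mu>, r, \<kappa>)" "l > 0"
  shows "\<mu> (Suc i) \<le> \<mu> i" "\<mu> i < \<mu> (Suc i) + l" "Suc (\<mu> 0) < \<mu> 1 + l"
proof -
  have \<mu>: "is_partition \<mu>" and nh: "\<not> hook_rows l \<mu> a b" for a b
    using assms by (auto simp: admissible_def core_iff)
  show mono: "\<mu> (Suc i) \<le> \<mu> i" for i using is_partitionD[OF \<mu>] by simp
  show gap: "\<mu> i < \<mu> (Suc i) + l" for i
    using nh[of i i] assms(2) by (auto simp: hook_rows_def)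
  have "\<mu> 0 - \<mu> 1 \<noteq> l - 1" using assms(1) by (simp add: admissible_def)
  then show "Suc (\<mu> 0) < \<mu> 1 + l" using gap[of 0] mono[of 0] assms(2) by simp
qed

lemma admissible_kappa:
  assumes "admissible l (\<mu>, r, \<kappa>)"
  shows "is_partition \<kappa>" "i > r \<Longrightarrow> \<kappa> i = 0"
  using assms by (auto simp: admissible_def)

text \<open>Above row \<open>r\<close> the gap at row \<open>i\<close> is
  \<open>l - 1 + l * (\<kappa> i - \<kappa> (Suc i))\<close>, written without subtraction. It holds
  for \<open>Suc i = r\<close> as well, since \<open>nu\<close> continues with
  \<open>\<mu> 0\<close> there.\<close>

lemma assemble_top:
  assumes "i < r" "l > 0"
  shows "assemble l \<mu> r \<kappa> i + 1 + l * \<kappa> (Suc i) = assemble l \<mu> r \<kappa> (Suc i) + l + l * \<kappa> i"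
proof -
  obtain d where r: "r = Suc (i + d)" using assms(1) less_iff_Suc_add by blast
  obtain m where l: "l = Suc m" using assms(2) gr0_implies_Suc by blast
  show ?thesis by (cases d) (simp_all add: assemble_def nu_def r l)
qed

lemma assemble_r: "assemble l \<mu> r \<kappa> r = \<mu> 0 + l * \<kappa> r"
  by (simp add: assemble_def nu_def)

lemma assemble_bottom: "i > r \<Longrightarrow> assemble l \<mu> r \<kappa> i = \<mu> (i - r)"
  by (simp add: assemble_def nu_def)

lemma assemble_update:
  "i \<le> r \<Longrightarrow> assemble l \<mu> r (\<kappa>(i := k)) = (assemble l \<mu> r \<kappa>)(i := nu l \<mu> r i + l * k)"
  by (auto simp: assemble_def fun_eq_iff)

lemma is_partition_assemble:
  assumes ad: "admissible l (\<mu>, r, \<kappa>)" and l: "l > 0"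
  shows "is_partition (assemble l \<mu> r \<kappa>)"
  unfolding is_partition_iff
proof
  let ?p = "assemble l \<mu> r \<kappa>"
  show "\<forall>i. ?p (Suc i) \<le> ?p i"
  proof
    fix i
    consider "i < r" | "i = r" | "i > r" by linarith
    then show "?p (Suc i) \<le> ?p i"
    proof cases
      case 1
      have "\<kappa> (Suc i) \<le> \<kappa> i" using is_partitionD[OF admissible_kappa(1)[OF ad]] by simp
      then have "l * \<kappa> (Suc i) \<le> l * \<kappa> i" by simp
      then show ?thesis using assemble_top[OF 1 l, of \<mu> \<kappa>] l by linarith
    next
      case 2
      then show ?thesis
        using admissible_gap(1)[OF ad l, of 0] by (simp add: assemble_r assemble_bottom)
    next
      case 3
      then show ?thesis
        using admissible_gap(1)[OF ad l, of "i - r"] by (simp add: assemble_bottom Suc_diff_le)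
    qed
  qed
  have fin: "finite {i. \<mu> i \<noteq> 0}"
    using ad by (auto simp: admissible_def core_def is_partition_def)
  have "{i. ?p i \<noteq> 0} \<subseteq> {..r} \<union> (\<lambda>j. j + r) ` {i. \<mu> i \<noteq> 0}"
  proof
    fix i assume i: "i \<in> {i. ?p i \<noteq> 0}"
    show "i \<in> {..r} \<union> (\<lambda>j. j + r) ` {i. \<mu> i \<noteq> 0}"
    proof (cases "i \<le> r")
      case False
      then have "i = (i - r) + r" "\<mu> (i - r) \<noteq> 0" using i by (simp_all add: assemble_bottom)
      then show ?thesis by blast
    qed simp
  qed
  then show "finite {i. ?p i \<noteq> 0}" by (rule finite_subset) (use fin in simp)
qed

section \<open>Assembled partitions are \<open>l\<close>-partitions\<close>

text \<open>A hook starting in row \<open>a\<close> and reaching further down needs a gap below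
  \<open>l - 1\<close> at \<open>a\<close>. This forces \<open>a \<ge> r\<close>, and
  \<open>\<kappa> r = 0\<close> if \<open>a = r\<close>, so the hook would already be one of the
  core \<open>\<mu>\<close>.\<close>

lemma assemble_no_nonhorizontal:
  assumes ad: "admissible l (\<mu>, r, \<kappa>)" and l: "l > 0" and ab: "a < b"
  shows "\<not> hook_rows l (assemble l \<mu> r \<kappa>) a b"
proof
  let ?p = "assemble l \<mu> r \<kappa>"
  assume h: "hook_rows l ?p a b"
  note p = is_partition_assemble[OF ad l]
  \<comment> \<open>The upper bound in \<open>hook_rows\<close> is combined with
    \<open>p b \<le> p (Suc a)\<close> and \<open>b - a \<ge> 1\<close>.\<close>
  have gap: "?p a + 1 < ?p (Suc a) + l"
    using h is_partitionD[OF p, of "Suc a" b] ab by (auto simp: hook_rows_def)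
  have "a \<ge> r"
  proof (rule ccontr)
    assume "\<not> a \<ge> r"
    then have "?p a + 1 + l * \<kappa> (Suc a) = ?p (Suc a) + l + l * \<kappa> a"
      using assemble_top[of a r l] l by simp
    moreover have "l * \<kappa> (Suc a) \<le> l * \<kappa> a"
      using is_partitionD[OF admissible_kappa(1)[OF ad]] by simp
    ultimately show False using gap by linarith
  qed
  moreover have "\<kappa> r = 0" if "a = r"
  proof (rule ccontr)
    assume "\<kappa> r \<noteq> 0"
    then have "l \<le> l * \<kappa> r" by simp
    moreover have "\<mu> 1 \<le> \<mu> 0" using admissible_gap(1)[OF ad l, of 0] by simp
    moreover have "\<mu> 0 + l * \<kappa> r + 1 < \<mu> 1 + l"
      using gap that by (simp add: assemble_r assemble_bottom)
    ultimately show False by linarith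
  qed
  ultimately have eq: "?p k = \<mu> (k - r)" if "k \<ge> a" for k
    using that assemble_bottom[of r k] assemble_r[of l \<mu> r \<kappa>] by (cases "k = r") auto
  have "hook_rows l \<mu> (a - r) (b - r)"
  proof -
    obtain c d where "a = r + c" "b = r + d" using \<open>a \<ge> r\<close> ab by (metis le_Suc_ex less_imp_le le_trans)
    then show ?thesis
      using h ab eq[of a] eq[of b] eq[of "Suc b"] by (simp add: hook_rows_def Suc_diff_le)
  qed
  then show False using ad l by (simp add: admissible_def core_iff)
qed

text \<open>Gaps of size at least \<open>l\<close> occur only at rows \<open>i \<le> r\<close> with
  \<open>\<kappa> (Suc i) < \<kappa> i\<close>, so the removal takes a corner box off
  \<open>\<kappa>\<close> and keeps \<open>\<mu>\<close> and \<open>r\<close>.\<close>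

lemma assemble_remove:
  assumes ad: "admissible l (\<mu>, r, \<kappa>)" and l: "l > 0"
    and rem: "remove_horizontal l (assemble l \<mu> r \<kappa>) q"
  shows "\<exists>\<kappa>'. admissible l (\<mu>, r, \<kappa>') \<and> q = assemble l \<mu> r \<kappa>'"
proof -
  let ?p = "assemble l \<mu> r \<kappa>"
  obtain i where i: "?p (Suc i) + l \<le> ?p i" "q = ?p(i := ?p i - l)"
    using rem remove_horizontal_iff[OF is_partition_assemble[OF ad l] l] by blast
  have \<kappa>: "is_partition \<kappa>" using admissible_kappa[OF ad] by simp
  have ir: "i \<le> r"
  proof (rule ccontr)
    assume "\<not> i \<le> r"
    then show False
      using i admissible_gap(2)[OF ad l, of "i - r"] by (simp add: assemble_bottom Suc_diff_le)
  qed
  have less: "\<kappa> (Suc i) < \<kappa> i"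
  proof (cases "i < r")
    case True
    have "l * \<kappa> (Suc i) < l * \<kappa> i" using assemble_top[OF True l, of \<mu> \<kappa>] i(1) by linarith
    then show ?thesis by simp
  next
    case False
    \<comment> \<open>At row \<open>r\<close> the gap is
      \<open>\<mu> 0 - \<mu> 1 + l * \<kappa> r\<close> with \<open>\<mu> 0 - \<mu> 1 < l\<close>,
      so \<open>\<kappa> r\<close> cannot vanish, whereas
      \<open>\<kappa> (Suc r) = 0\<close>.\<close>
    then have "i = r" using ir by simp
    then have "\<kappa> r \<noteq> 0"
      using i admissible_gap(2)[OF ad l, of 0]
      by (cases "\<kappa> r = 0") (auto simp: assemble_r assemble_bottom)
    then show ?thesis using admissible_kappa(2)[OF ad] \<open>i = r\<close> by simp
  qed
  let ?k = "\<kappa>(i := \<kappa> i - 1)"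
  have "is_partition ?k" unfolding is_partition_iff
  proof
    show "\<forall>j. ?k (Suc j) \<le> ?k j"
    proof
      fix j show "?k (Suc j) \<le> ?k j"
        using less is_partitionD[OF \<kappa>, of j "Suc j"] by auto
    qed
    have "{j. ?k j \<noteq> 0} \<subseteq> {j. \<kappa> j \<noteq> 0}" by auto
    then show "finite {j. ?k j \<noteq> 0}"
      by (rule finite_subset) (use \<kappa> in \<open>simp add: is_partition_def\<close>)
  qed
  then have "admissible l (\<mu>, r, ?k)" using ad ir by (auto simp: admissible_def)
  moreover have "?p i - l = nu l \<mu> r i + l * (\<kappa> i - 1)"
    using less ir by (cases "\<kappa> i") (simp_all add: assemble_def)
  then have "q = assemble l \<mu> r ?k" using i(2) assemble_update[OF ir] by simp
  ultimately show ?thesis by blast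
qed

lemma l_partition_assemble:
  assumes ad: "admissible l (\<mu>, r, \<kappa>)" and l: "l \<ge> 2"
  shows "l_partition l (assemble l \<mu> r \<kappa>)"
proof -
  have l0: "l > 0" using l by simp
  have "\<exists>\<kappa>'. admissible l (\<mu>, r, \<kappa>') \<and> q = assemble l \<mu> r \<kappa>'"
    if "(remove_horizontal l)\<^sup>*\<^sup>* (assemble l \<mu> r \<kappa>) q" for q
    using that by induction (use ad assemble_remove[OF _ l0] in blast)+
  then have "\<nexists>H. rim_hook l q H \<and> \<not> horizontal H"
    if "(remove_horizontal l)\<^sup>*\<^sup>* (assemble l \<mu> r \<kappa>) q" for q
    using that nonhorizontal_iff[OF is_partition_assemble l0] assemble_no_nonhorizontal[OF _ l0]
      l0 by metis
  moreover have "regular l (assemble l \<mu> r \<kappa>)"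
    using regularI is_partition_assemble[OF ad l0] assemble_no_nonhorizontal[OF ad l0] l by blast
  ultimately show ?thesis unfolding l_partition_def using is_partition_assemble[OF ad l0] by blast
qed

section \<open>Every \<open>l\<close>-partition is assembled from a triple\<close>

lemma core_decomposes:
  assumes p: "core l p" and l: "l \<ge> 2"
  shows "\<exists>\<mu> r \<kappa>. admissible l (\<mu>, r, \<kappa>) \<and> p = assemble l \<mu> r \<kappa>"
proof -
  have part: "is_partition p" and nh: "\<not> hook_rows l p a b" for a b
    using p l by (auto simp: core_iff)
  \<comment> \<open>The first row whose gap differs from \<open>l - 1\<close>. It exists because the
    gaps are eventually 0 and \<open>l \<ge> 2\<close>; stopping there yields the condition on the
    first gap of \<open>\<mu>\<close>.\<close>
  define r where "r = (LEAST i. p i - p (Suc i) \<noteq> l - 1)"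
  have "\<exists>i. p i = 0"
    using ex_new_if_finite[of "{i. p i \<noteq> 0}"] part by (auto simp: is_partition_def)
  then obtain i where "p i = 0" by blast
  then have "p i - p (Suc i) \<noteq> l - 1" using l by simp
  then have "\<exists>i. p i - p (Suc i) \<noteq> l - 1" by blast
  then have r: "p r - p (Suc r) \<noteq> l - 1" unfolding r_def by (rule LeastI_ex)
  have top: "p i = p (Suc i) + (l - 1)" if "i < r" for i
    using not_less_Least[OF that[unfolded r_def]] l by auto
  have lead: "p j = p r + (r - j) * (l - 1)" if "j \<le> r" for j
    using that
  proof (induction j rule: inc_induct)
    case base
    then show ?case by simp
  next
    case (step n)
    have "r - n = Suc (r - Suc n)" using step.hyps by simp
    then show ?case using step top[of n] by simp
  qed
  define \<mu> where "\<mu> j = p (r + j)" for j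
  have "finite {j. \<mu> j \<noteq> 0}"
  proof (rule inj_on_finite)
    show "(\<lambda>j. r + j) ` {j. \<mu> j \<noteq> 0} \<subseteq> {i. p i \<noteq> 0}" by (auto simp: \<mu>_def)
  qed (use part in \<open>simp_all add: is_partition_def\<close>)
  then have "is_partition \<mu>" using is_partitionD[OF part] by (simp add: is_partition_iff \<mu>_def)
  \<comment> \<open>\<open>hook_rows\<close> is invariant under a common shift of the rows, so a
    tail of a core is a core.\<close>
  moreover have "\<not> hook_rows l \<mu> a b" for a b
    using nh[of "r + a" "r + b"] by (auto simp: hook_rows_def \<mu>_def)
  ultimately have "admissible l (\<mu>, r, \<lambda>_. 0)"
    using r l by (simp add: admissible_def core_iff \<mu>_def is_partition_iff)
  moreover have "p = assemble l \<mu> r (\<lambda>_. 0)"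
  proof
    fix i show "p i = assemble l \<mu> r (\<lambda>_. 0) i"
      using lead[of i] by (cases "i < r") (simp_all add: assemble_def nu_def \<mu>_def)
  qed
  ultimately show ?thesis by blast
qed

text \<open>Putting back a hook in a row \<open>i \<le> r\<close> adds a box to
  \<open>\<kappa>\<close>. A row \<open>i > r\<close> has to be excluded: the gaps of
  \<open>\<mu>\<close> leave only \<open>i = Suc r\<close>, and there the choice of the topmost hook
  together with the bound on \<open>\<mu> 0 - \<mu> 1\<close> produces a non-horizontal
  hook.\<close>

lemma assemble_add:
  assumes ad: "admissible l (\<mu>, r, \<kappa>)" and l: "l \<ge> 2" and p: "l_partition l p"
    and topmost: "\<And>j. j < i \<Longrightarrow> p j < p (Suc j) + l"
    and pi: "l \<le> p i" and eq: "p(i := p i - l) = assemble l \<mu> r \<kappa>"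
  shows "\<exists>\<kappa>'. admissible l (\<mu>, r, \<kappa>') \<and> p = assemble l \<mu> r \<kappa>'"
proof -
  let ?q = "assemble l \<mu> r \<kappa>"
  have l0: "l > 0" using l by simp
  have part: "is_partition p" using p by (simp add: l_partition_def)
  have nh: "\<not> hook_rows l p a b" if "a < b" for a b
    using p nonhorizontal_iff[OF part l0] that by (auto simp: l_partition_def)
  have p_eq: "p = ?q(i := ?q i + l)" using pi by (auto simp flip: eq)
  have \<kappa>: "is_partition \<kappa>" using admissible_kappa[OF ad] by simp
  \<comment> \<open>Row \<open>j\<close> is the same in \<open>p\<close> and \<open>?q\<close>, and
    \<open>p i \<le> p j\<close> with \<open>p i = ?q i + l\<close>.\<close>
  have above: "?q i + l \<le> ?q j" if "i = Suc j" for j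
    using is_partitionD[OF part, of j i] p_eq that
    by (metis fun_upd_other fun_upd_same le_SucI n_not_Suc_n order_refl)
  have ir: "i \<le> r"
  proof (rule ccontr)
    assume "\<not> i \<le> r"
    then obtain j where j: "i = Suc j" "r \<le> j" by (cases i) auto
    have "j = r"
    proof (rule ccontr)
      assume "j \<noteq> r"
      then show False using above[OF j(1)] j admissible_gap(2)[OF ad l0, of "j - r"]
        by (simp add: assemble_bottom Suc_diff_le)
    qed
    have k0: "\<kappa> r \<noteq> 0" using above[OF j(1)] \<open>j = r\<close> j admissible_gap(2)[OF ad l0, of 0]
      by (cases "\<kappa> r = 0") (auto simp: assemble_r assemble_bottom)
    have pr: "p r = \<mu> 0 + l * \<kappa> r" "p (Suc r) = \<mu> 1 + l" "p (Suc (Suc r)) = \<mu> 2"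
      using j \<open>j = r\<close> by (simp_all add: p_eq assemble_r assemble_bottom)
    obtain k where k: "\<kappa> r = Suc k" using k0 not0_implies_Suc by blast
    \<comment> \<open>No horizontal hook starts in row \<open>r\<close>, which bounds
      \<open>\<kappa> r\<close> from above and leaves only \<open>\<kappa> r = 1\<close>.\<close>
    have "p r < p (Suc r) + l" using topmost[of r] j \<open>j = r\<close> by simp
    then have "l * k < l"
      using pr admissible_gap(1)[OF ad l0, of 0] admissible_gap(3)[OF ad l0]
      unfolding k mult_Suc_right One_nat_def by linarith
    then have "k = 0" by simp
    then have "p r = \<mu> 0 + l" using pr k by simp
    \<comment> \<open>The required inequalities reduce to \<open>\<mu> 2 \<le> Suc (\<mu> 0)\<close>
      and \<open>Suc (\<mu> 0) < \<mu> 1 + l\<close>; the second rests on the excluded gap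
      \<open>l - 1\<close>.\<close>
    then have "hook_rows l p r (Suc r)"
      using pr admissible_gap(1)[OF ad l0, of 0] admissible_gap(1)[OF ad l0, of 1]
        admissible_gap(3)[OF ad l0]
      by (simp add: hook_rows_def numeral_2_eq_2)
    then show False using nh by simp
  qed
  let ?k = "\<kappa>(i := Suc (\<kappa> i))"
  have less: "\<kappa> i < \<kappa> j" if "i = Suc j" for j
  proof -
    \<comment> \<open>By the gap formula, a gap of at least \<open>l\<close> at row \<open>j\<close>
      means a strict descent of \<open>\<kappa>\<close>, which leaves room for the new box.\<close>
    have "j < r" using that ir by simp
    then have "l * \<kappa> i < l * \<kappa> j"
      using assemble_top[of j r l \<mu> \<kappa>] above[OF that] l0 unfolding that by linarith
    then show ?thesis by simp
  qed
  have "is_partition ?k" unfolding is_partition_iff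
  proof
    show "\<forall>j. ?k (Suc j) \<le> ?k j"
    proof
      fix j show "?k (Suc j) \<le> ?k j"
        using less[of j] is_partitionD[OF \<kappa>, of j "Suc j"] by auto
    qed
    have "{j. ?k j \<noteq> 0} \<subseteq> insert i {j. \<kappa> j \<noteq> 0}" by auto
    then show "finite {j. ?k j \<noteq> 0}"
      by (rule finite_subset) (use \<kappa> in \<open>simp add: is_partition_def\<close>)
  qed
  then have "admissible l (\<mu>, r, ?k)" using ad ir by (auto simp: admissible_def)
  moreover have "p = assemble l \<mu> r ?k"
    unfolding assemble_update[OF ir] using p_eq ir by (simp add: assemble_def algebra_simps)
  ultimately show ?thesis by blast
qed

lemma l_partition_decomposes:
  assumes l: "l \<ge> 2" and "l_partition l p"
  shows "\<exists>\<mu> r \<kappa>. admissible l (\<mu>, r, \<kappa>) \<and> p = assemble l \<mu> r \<kappa>"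
  using assms(2)
proof (induction "card (young_diagram p)" arbitrary: p rule: less_induct)
  case less
  have l0: "l > 0" using l by simp
  have part: "is_partition p" using less.prems by (simp add: l_partition_def)
  have nh: "\<not> hook_rows l p a b" if "a < b" for a b
    using less.prems nonhorizontal_iff[OF part l0] that by (auto simp: l_partition_def)
  show ?case
  proof (cases "\<exists>i. p (Suc i) + l \<le> p i")
    case False
    then have "\<not> hook_rows l p a a" for a by (auto simp: hook_rows_def)
    with nh have "core l p" using part l0
      by (metis core_iff hook_rows_def nat_less_le)
    then show ?thesis using core_decomposes l by blast
  next
    case True
    \<comment> \<open>The least such row supplies the hypothesis \<open>topmost\<close> of
      \<open>assemble_add\<close>.\<close>
    define i where "i = (LEAST i. p (Suc i) + l \<le> p i)"
    have i: "p (Suc i) + l \<le> p i" unfolding i_def using True by (rule LeastI_ex)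
    have topmost: "p j < p (Suc j) + l" if "j < i" for j
      using not_less_Least[OF that[unfolded i_def]] by simp
    let ?q = "p(i := p i - l)"
    have rem: "remove_horizontal l p ?q" using remove_horizontal_iff[OF part l0] i by blast
    have "young_diagram ?q \<subseteq> young_diagram p"
      by (simp add: young_diagram_subset_iff le_fun_def)
    moreover have "(i, p i - l) \<in> young_diagram p - young_diagram ?q" using i l0 by simp
    ultimately have "young_diagram ?q \<subset> young_diagram p" by blast
    then have "card (young_diagram ?q) < card (young_diagram p)"
      by (rule psubset_card_mono[OF finite_young_diagram[OF part]])
    then obtain \<mu> r \<kappa> where "admissible l (\<mu>, r, \<kappa>)" "?q = assemble l \<mu> r \<kappa>"
      using less.hyps l_partition_step[OF less.prems rem l] by blast
    then show ?thesis
      using assemble_add[OF _ l less.prems topmost] i by (metis add_leD2)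
  qed
qed

section \<open>Uniqueness of the triple\<close>

text \<open>Modulo \<open>l\<close>, the gaps of \<open>assemble l \<mu> r \<kappa>\<close> are \<open>-1\<close> above row \<open>r\<close> but not at row \<open>r\<close>.\<close>

lemma assemble_r_le:
  assumes ad: "admissible l (\<mu>, r, \<kappa>)" and ad': "admissible l (\<mu>', r', \<kappa>')" and l: "l > 0"
    and eq: "assemble l \<mu> r \<kappa> = assemble l \<mu>' r' \<kappa>'"
  shows "r' \<le> r"
proof (rule ccontr)
  assume "\<not> r' \<le> r"
  then have "r < r'" by simp
  from assemble_top[OF this l, of \<mu>' \<kappa>']
  have top: "\<mu> 0 + l * \<kappa> r + 1 + l * \<kappa>' (Suc r) = \<mu> 1 + l + l * \<kappa>' r"
    by (simp add: assemble_r assemble_bottom flip: eq)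
  \<comment> \<open>One more than the first gap of \<open>\<mu>\<close>. Computing the gap at row
    \<open>r\<close> from both triples makes \<open>?d\<close> a multiple of \<open>l\<close>,
    although \<open>0 < ?d < l\<close>.\<close>
  let ?d = "Suc (\<mu> 0) - \<mu> 1"
  have \<mu>: "\<mu> 1 \<le> \<mu> 0" using admissible_gap(1)[OF ad l, of 0] by simp
  have "?d + l * (\<kappa> r + \<kappa>' (Suc r)) = l * Suc (\<kappa>' r)"
    using top \<mu> by (simp add: distrib_left)
  then have "l dvd ?d + l * (\<kappa> r + \<kappa>' (Suc r))" by simp
  then have "l dvd ?d" by (simp add: dvd_add_left_iff)
  moreover have "0 < ?d" "?d < l" using \<mu> admissible_gap(3)[OF ad l] by auto
  ultimately show False by (simp add: nat_dvd_not_less)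
qed

text \<open>Once \<open>r\<close> is known, the rows below it give all parts of \<open>\<mu>\<close>
  but the first. Row \<open>r\<close> separates \<open>\<mu> 0\<close> from
  \<open>\<kappa> r\<close> by division with remainder, and the rows above give the rest of
  \<open>\<kappa>\<close>.\<close>

lemma assemble_inject:
  assumes ad: "admissible l (\<mu>, r, \<kappa>)" and ad': "admissible l (\<mu>', r', \<kappa>')" and l: "l > 0"
    and eq: "assemble l \<mu> r \<kappa> = assemble l \<mu>' r' \<kappa>'"
  shows "\<mu> = \<mu>' \<and> r = r' \<and> \<kappa> = \<kappa>'"
proof -
  have r: "r' = r" using assemble_r_le[OF ad ad' l eq] assemble_r_le[OF ad' ad l eq[symmetric]] by simp
  have pos: "\<mu> j = \<mu>' j" if "j > 0" for j
    using fun_cong[OF eq, of "r + j"] that by (simp add: r assemble_bottom)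
  have eq_r: "\<mu> 0 + l * \<kappa> r = \<mu>' 0 + l * \<kappa>' r"
    using fun_cong[OF eq, of r] by (simp add: r assemble_r)
  \<comment> \<open>Measured from the common value \<open>\<mu> 1 = \<mu>' 1\<close>, both first
    parts are remainders below \<open>l\<close>.\<close>
  define d where "d = \<mu> 0 - \<mu> 1"
  define d' where "d' = \<mu>' 0 - \<mu> 1"
  have d: "\<mu> 0 = \<mu> 1 + d" "d < l" "\<mu>' 0 = \<mu> 1 + d'" "d' < l"
    using admissible_gap(1,2)[OF ad l, of 0] admissible_gap(1,2)[OF ad' l, of 0] pos[of 1]
    by (auto simp: d_def d'_def)
  have "d + l * \<kappa> r = d' + l * \<kappa>' r" using eq_r d by simp
  then have "(d + l * \<kappa> r) mod l = (d' + l * \<kappa>' r) mod l" by simp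
  then have "d = d'" using d by simp
  then have zero: "\<mu> 0 = \<mu>' 0" using d by simp
  have \<mu>: "\<mu> = \<mu>'" using pos zero by (metis ext neq0_conv)
  have "\<kappa> i = \<kappa>' i" for i
  proof (cases "i \<le> r")
    case True
    then show ?thesis using fun_cong[OF eq, of i] l by (simp add: assemble_def r \<mu>)
  next
    case False
    then show ?thesis using admissible_kappa(2)[OF ad] admissible_kappa(2)[OF ad'] r by simp
  qed
  then show ?thesis using \<mu> r by auto
qed

theorem theorem2p3p2p2:
  fixes l :: nat
  assumes "l \<ge> 2"
  shows "(\<forall>\<mu> r \<kappa>. admissible l (\<mu>, r, \<kappa>) \<longrightarrow> l_partition l (assemble l \<mu> r \<kappa>)) \<and>
         (\<forall>p. l_partition l p \<longrightarrow> (\<exists>!t. admissible l t \<and> decomposes l p t))"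
proof (intro conjI allI impI)
  fix \<mu> r \<kappa>
  assume "admissible l (\<mu>, r, \<kappa>)"
  then show "l_partition l (assemble l \<mu> r \<kappa>)" using l_partition_assemble assms by blast
next
  fix p
  assume "l_partition l p"
  then obtain \<mu> r \<kappa> where ex: "admissible l (\<mu>, r, \<kappa>)" "p = assemble l \<mu> r \<kappa>"
    using l_partition_decomposes assms by blast
  show "\<exists>!t. admissible l t \<and> decomposes l p t"
  proof (rule ex1I[of _ "(\<mu>, r, \<kappa>)"])
    show "admissible l (\<mu>, r, \<kappa>) \<and> decomposes l p (\<mu>, r, \<kappa>)" using ex by (simp add: decomposes_def)
  next
    fix t assume t: "admissible l t \<and> decomposes l p t"
    obtain \<mu>' r' \<kappa>' where t_eq: "t = (\<mu>', r', \<kappa>')" by (cases t)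
    have "assemble l \<mu>' r' \<kappa>' = assemble l \<mu> r \<kappa>" using t ex by (simp add: t_eq decomposes_def)
    moreover have "admissible l (\<mu>', r', \<kappa>')" using t by (simp add: t_eq)
    ultimately show "t = (\<mu>, r, \<kappa>)"
      using assemble_inject[of l \<mu>' r' \<kappa>' \<mu> r \<kappa>] ex(1) assms unfolding t_eq by auto
  qed
qed

end
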